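(* Let $m_1,m_2$ be sequences preserving summability, $s_1,s_2\ge0$, and let $\tilde m_1=m_1\Gamma_{s_1}$, $\tilde m_2=m_2\Gamma_{s_2}$ be the corresponding sequences of generalized moments. Let $P(\lambda,\zeta)$ be a polynomial of two variables (with complex coefficients) of order $p$ with respect to $\lambda$, and let $\varphi_j(z)\in\mathcal{O}(D)$ for $j=0,\dots,p-1$. Consider the Cauchy problems $$(\mathrm{I})\quad P(\partial_{\tilde m_1,t},\partial_{\tilde m_2,z})u=0,\qquad \partial^j_{\tilde m_1,t}u(0,z)=\varphi_j(z),\quad j=0,\dots,p-1,$$ and $$(\mathrm{II})\quad P(\partial_{\Gamma_{s_1},t},\partial_{\Gamma_{s_2},z})v=0,\qquad \partial^j_{\Gamma_{s_1},t}v(0,z)=\hat{\mathcal{B}}_{m_2^{-1},z}\varphi_j(z),\quad j=0,\dots,p-1.$$ The formal power series $\hat u\in\mathcal{O}[[t]]$ is a formal solution of (I) if and only if $\hat v=\hat{\mathcal{B}}_{m_1^{-1},t}\hat{\mathcal{B}}_{m_2^{-1},z}\hat u\in\mathcal{O}[[t]]$ is a formal solution of (II). Moreover, for every $k>0$ and $d\in\mathbb{R}$ one has $\hat u\in\mathcal{O}\{t\}_{k,d}$ if and only if $\hat v\in\mathcal{O}\{t\}_{k,d}$.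
   Context: All sequences $m=(m(n))_{n\ge0}$ are sequences of positive real numbers with $m(0)=1$; products and inverses are termwise; $\Gamma_s=(\Gamma(1+sn))_{n\ge0}$ for $s\ge0$. $D_r=\{z\in\mathbb{C}:|z|<r\}$; $D$ denotes such a disc with unspecified radius, which may change from one occurrence to another. $\mathcal{O}(D)$ is the set of holomorphic functions on $D$. $\mathcal{O}_r$ is the Banach space of functions holomorphic on $D_r$ and continuous on $\overline{D}_r$ with the sup norm; when the radius is not essential it is written $\mathcal{O}$, i.e. statements about $\mathcal{O}[[t]]$ and $\mathcal{O}\{t\}_{k,d}$ mean that they hold with $\mathcal{O}=\mathcal{O}_r$ for some $r>0$ (possibly shrinking). For a complex Banach space $\mathbb{E}$ and $\sum_n a_nt^n\in\mathbb{E}[[t]]$: $\hat{\mathcal{B}}_{m,t}\big(\sum_na_nt^n\big)=\sum_n\frac{a_n}{m(n)}t^n$ ($m$-Borel operator) and $\partial_{m,t}\big(\sum_na_nt^n\big)=\sum_n\frac{m(n+1)}{m(n)}a_{n+1}t^n$ ($m$-moment differential operator); $\hat{\mathcal{B}}_{m,z}$ and $\partial_{m,z}$ are defined in the same way with respect to the power series expansion in $z$. Summability. For $d\in\mathbb{R}$, $\alpha>0$ let $S_d(\alpha)=\{re^{i\phi}: r>0,\ |\phi-d|<\alpha/2\}$ in the universal covering of $\mathbb{C}\setminus\{0\}$. For $k>0$, $\mathcal{O}^k(S_d(\alpha)\cup D_r,\mathbb{E})$ is the space of $\mathbb{E}$-valued holomorphic functions $f$ on $S_d(\alpha)\cup D_r$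 such that for all $\tilde\alpha\in(0,\alpha)$, $\tilde r\in(0,r)$ there are $A,B>0$ with $\|f(t)\|<Ae^{B|t|^k}$ on $S_d(\tilde\alpha)\cup D_{\tilde r}$. A series $\hat u\in\mathbb{E}[[t]]$ is $k$-summable in the direction $d$, written $\hat u\in\mathbb{E}\{t\}_{k,d}$, if $\hat{\mathcal{B}}_{\Gamma_{1/k},t}\hat u\in\mathcal{O}^k(S_d(\alpha)\cup D_r,\mathbb{E})$ for some $\alpha,r>0$. A sequence $m$ preserves summability if for every $k>0$, $d\in\mathbb{R}$, complex Banach space $\mathbb{E}$ and $\hat u\in\mathbb{E}[[t]]$: $\hat u\in\mathbb{E}\{t\}_{k,d}$ if and only if $\hat{\mathcal{B}}_{m,t}\hat u\in\mathbb{E}\{t\}_{k,d}$. A sequence of generalized moments of order $s\ge0$ is a sequence $m\Gamma_s$ with $m$ preserving summability. *)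

theory Defs
  imports "HOL-Complex_Analysis.Complex_Analysis" "HOL-Algebra.Module"
begin

section \<open>Complex Banach spaces\<close>

text \<open>
  The coefficient spaces include the spaces \<open>\<O>\<^sub>r\<close>, which depend on the real number \<open>r\<close>, so Banach
  spaces are set-based: a module over the field of complex numbers together with a norm.
  The fields \<open>mult\<close> and \<open>one\<close>, which the record type of modules inherits from that of rings,
  play no role.
\<close>

definition complex_ring :: "complex ring" where
  "complex_ring = \<lparr>carrier = UNIV, mult = (*), one = 1, zero = 0, add = (+)\<rparr>"

record 'e normed_module = "(complex, 'e) module" +
  vnorm :: "'e \<Rightarrow> real"

definition complex_banach :: "('e, 'x) normed_module_scheme \<Rightarrow> bool" where
  "complex_banach E \<longleftrightarrow>
     module complex_ring E \<and>
     (\<forall>x\<in>carrier E. 0 \<le> vnorm E x \<and> (vnorm E x = 0 \<longleftrightarrow> x = \<zero>\<^bsub>E\<^esub>)) \<and>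
     (\<forall>c. \<forall>x\<in>carrier E. vnorm E (c \<odot>\<^bsub>E\<^esub> x) = cmod c * vnorm E x) \<and>
     (\<forall>x\<in>carrier E. \<forall>y\<in>carrier E. vnorm E (x \<oplus>\<^bsub>E\<^esub> y) \<le> vnorm E x + vnorm E y) \<and>
     (\<forall>\<sigma> :: nat \<Rightarrow> 'e. range \<sigma> \<subseteq> carrier E \<longrightarrow>
        (\<forall>\<epsilon>>0. \<exists>N. \<forall>i\<ge>N. \<forall>j\<ge>N. vnorm E (\<sigma> i \<ominus>\<^bsub>E\<^esub> \<sigma> j) < \<epsilon>) \<longrightarrow>
        (\<exists>l\<in>carrier E. (\<lambda>i. vnorm E (\<sigma> i \<ominus>\<^bsub>E\<^esub> l)) \<longlonglongrightarrow> 0))"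

definition vholomorphic_on ::
  "('e, 'x) normed_module_scheme \<Rightarrow> (complex \<Rightarrow> 'e) \<Rightarrow> complex set \<Rightarrow> bool" where
  "vholomorphic_on E f U \<longleftrightarrow>
     (\<forall>z\<in>U. f z \<in> carrier E) \<and>
     (\<forall>z\<in>U. \<exists>f'\<in>carrier E.
        ((\<lambda>h. vnorm E ((1 / h) \<odot>\<^bsub>E\<^esub> (f (z + h) \<ominus>\<^bsub>E\<^esub> f z) \<ominus>\<^bsub>E\<^esub> f')) \<longlongrightarrow> 0) (at 0))"

text \<open>
  The Banach space \<open>\<O>\<^sub>r\<close>. Its elements are functions on the closed disc; they are extended by \<open>0\<close>
  so that equality in the space is equality of HOL functions.
\<close>

definition disc_space :: "real \<Rightarrow> (complex \<Rightarrow> complex) normed_module" where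
  "disc_space r =
     \<lparr>carrier = {f. continuous_on (cball 0 r) f \<and> f holomorphic_on ball 0 r \<and>
                    (\<forall>z. z \<notin> cball 0 r \<longrightarrow> f z = 0)},
      mult = (\<lambda>f g z. f z * g z),
      one = (\<lambda>z. if z \<in> cball 0 r then 1 else 0),
      zero = (\<lambda>z. 0),
      add = (\<lambda>f g z. f z + g z),
      smult = (\<lambda>c f z. c * f z),
      vnorm = (\<lambda>f. SUP z\<in>cball 0 r. cmod (f z))\<rparr>"


section \<open>Summability\<close>

definition gamma_seq :: "real \<Rightarrow> nat \<Rightarrow> real" where
  "gamma_seq s n = Gamma (1 + s * real n)"

text \<open>
  A series in powers of \<open>t\<close> with coefficients in \<open>E\<close> is given by its coefficient sequence.
\<close>

definition vborel ::
  "('e, 'x) normed_module_scheme \<Rightarrow> (nat \<Rightarrow> real) \<Rightarrow> (nat \<Rightarrow> 'e) \<Rightarrow> nat \<Rightarrow> 'e" where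
  "vborel E m a n = (1 / complex_of_real (m n)) \<odot>\<^bsub>E\<^esub> a n"

text \<open>
  A point of the universal covering of \<open>\<complex> - {0}\<close> is represented by its logarithm \<open>w\<close>; the covering
  map is \<open>exp\<close>, and \<open>w\<close> is a global holomorphic coordinate. The sector \<open>S\<^sub>d(\<alpha>)\<close> is then the strip
  \<open>|Im w - d| < \<alpha>/2\<close>.
\<close>

definition sector :: "real \<Rightarrow> real \<Rightarrow> complex set" where
  "sector d \<alpha> = {w. \<bar>Im w - d\<bar> < \<alpha> / 2}"

text \<open>
  An element of \<open>\<O>\<^sup>k(S\<^sub>d(\<alpha>) \<union> D\<^sub>r, E)\<close> is a pair consisting of its restriction \<open>f\<close> to the disc and
  its restriction \<open>g\<close> to the sector (in the coordinate \<open>w\<close>), which agree where \<open>|exp w| < r\<close>.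
\<close>

definition exp_growth_holomorphic ::
  "('e, 'x) normed_module_scheme \<Rightarrow> real \<Rightarrow> real \<Rightarrow> real \<Rightarrow> real \<Rightarrow>
     (complex \<Rightarrow> 'e) \<Rightarrow> (complex \<Rightarrow> 'e) \<Rightarrow> bool" where
  "exp_growth_holomorphic E k d \<alpha> r f g \<longleftrightarrow>
     vholomorphic_on E f (ball 0 r) \<and>
     vholomorphic_on E g (sector d \<alpha>) \<and>
     (\<forall>w\<in>sector d \<alpha>. exp w \<in> ball 0 r \<longrightarrow> g w = f (exp w)) \<and>
     (\<forall>\<alpha>' r'. 0 < \<alpha>' \<and> \<alpha>' < \<alpha> \<and> 0 < r' \<and> r' < r \<longrightarrow>
        (\<exists>A>0. \<exists>B>0.
           (\<forall>t\<in>ball 0 r'. vnorm E (f t) < A * exp (B * cmod t powr k)) \<and>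
           (\<forall>w\<in>sector d \<alpha>'. vnorm E (g w) < A * exp (B * cmod (exp w) powr k))))"

definition k_summable ::
  "('e, 'x) normed_module_scheme \<Rightarrow> real \<Rightarrow> real \<Rightarrow> (nat \<Rightarrow> 'e) \<Rightarrow> bool" where
  "k_summable E k d a \<longleftrightarrow>
     (\<forall>n. a n \<in> carrier E) \<and>
     (\<exists>\<alpha>>0. \<exists>r>0. \<exists>f g. exp_growth_holomorphic E k d \<alpha> r f g \<and>
        (\<forall>t\<in>ball 0 r.
           (\<lambda>N. vnorm E ((\<Oplus>\<^bsub>E\<^esub>n\<in>{..<N}. t ^ n \<odot>\<^bsub>E\<^esub> vborel E (gamma_seq (1 / k)) a n)
                          \<ominus>\<^bsub>E\<^esub> f t)) \<longlonglongrightarrow> 0))"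

definition preserves_summability_in ::
  "('e, 'x) normed_module_scheme \<Rightarrow> (nat \<Rightarrow> real) \<Rightarrow> bool" where
  "preserves_summability_in E m \<longleftrightarrow>
     (\<forall>k>0. \<forall>d. \<forall>a. (\<forall>n. a n \<in> carrier E) \<longrightarrow>
        (k_summable E k d a \<longleftrightarrow> k_summable E k d (vborel E m a)))"

text \<open>
  HOL cannot quantify over types inside a formula, so \<open>E\<close> ranges over all complex Banach spaces
  whose carrier is a subset of the type \<open>complex \<Rightarrow> complex\<close>. This loses nothing: summability of a
  series can be tested in the closed linear span of its coefficients (which contains all values
  of its Borel sum), and that span is separable, hence has at most as many elements as \<open>complex\<close>
  and is isometrically isomorphic to a Banach space of this kind.
\<close>

definition preserves_summability :: "(nat \<Rightarrow> real) \<Rightarrow> bool" where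
  "preserves_summability m \<longleftrightarrow>
     (\<forall>n. 0 < m n) \<and> m 0 = 1 \<and>
     (\<forall>E :: (complex \<Rightarrow> complex) normed_module.
        complex_banach E \<longrightarrow> preserves_summability_in E m)"


section \<open>Formal power series in two variables\<close>

text \<open>
  A series in \<open>t\<close> whose coefficients are series in \<open>z\<close> has type \<^typ>\<open>complex fps fps\<close>, the outer
  variable being \<open>t\<close>. Holomorphic functions near \<open>0\<close> are identified with their Taylor series.
\<close>

definition borel_fps :: "(nat \<Rightarrow> real) \<Rightarrow> complex fps \<Rightarrow> complex fps" where
  "borel_fps m f = Abs_fps (\<lambda>n. fps_nth f n / complex_of_real (m n))"

definition moment_deriv :: "(nat \<Rightarrow> real) \<Rightarrow> complex fps \<Rightarrow> complex fps" where
  "moment_deriv m f = Abs_fps (\<lambda>n. complex_of_real (m (n + 1) / m n) * fps_nth f (n + 1))"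

definition borel_t :: "(nat \<Rightarrow> real) \<Rightarrow> complex fps fps \<Rightarrow> complex fps fps" where
  "borel_t m u = Abs_fps (\<lambda>n. fps_const (1 / complex_of_real (m n)) * fps_nth u n)"

definition borel_z :: "(nat \<Rightarrow> real) \<Rightarrow> complex fps fps \<Rightarrow> complex fps fps" where
  "borel_z m u = Abs_fps (\<lambda>n. borel_fps m (fps_nth u n))"

definition moment_deriv_t :: "(nat \<Rightarrow> real) \<Rightarrow> complex fps fps \<Rightarrow> complex fps fps" where
  "moment_deriv_t m u =
     Abs_fps (\<lambda>n. fps_const (complex_of_real (m (n + 1) / m n)) * fps_nth u (n + 1))"

definition moment_deriv_z :: "(nat \<Rightarrow> real) \<Rightarrow> complex fps fps \<Rightarrow> complex fps fps" where
  "moment_deriv_z m u = Abs_fps (\<lambda>n. moment_deriv m (fps_nth u n))"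

text \<open>
  A polynomial \<open>P(\<lambda>,\<zeta>)\<close> has type \<^typ>\<open>complex poly poly\<close>, the outer variable being \<open>\<lambda>\<close>; so
  \<open>degree P\<close> is its order with respect to \<open>\<lambda>\<close>.
\<close>

definition moment_pde_op ::
  "complex poly poly \<Rightarrow> (nat \<Rightarrow> real) \<Rightarrow> (nat \<Rightarrow> real) \<Rightarrow> complex fps fps \<Rightarrow> complex fps fps" where
  "moment_pde_op P mt mz u =
     (\<Sum>i\<le>degree P. \<Sum>j\<le>degree (coeff P i).
        fps_const (fps_const (coeff (coeff P i) j)) *
          (moment_deriv_t mt ^^ i) ((moment_deriv_z mz ^^ j) u))"

definition solves_cauchy ::
  "complex poly poly \<Rightarrow> (nat \<Rightarrow> real) \<Rightarrow> (nat \<Rightarrow> real) \<Rightarrow> (nat \<Rightarrow> complex fps) \<Rightarrow>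
     complex fps fps \<Rightarrow> bool" where
  "solves_cauchy P mt mz \<psi> u \<longleftrightarrow>
     moment_pde_op P mt mz u = 0 \<and>
     (\<forall>j<degree P. fps_nth ((moment_deriv_t mt ^^ j) u) 0 = \<psi> j)"

definition represents ::
  "real \<Rightarrow> (nat \<Rightarrow> complex \<Rightarrow> complex) \<Rightarrow> complex fps fps \<Rightarrow> bool" where
  "represents r a u \<longleftrightarrow>
     (\<forall>n. a n \<in> carrier (disc_space r) \<and> fps_expansion (a n) 0 = fps_nth u n)"

text \<open>\<open>\<O>[[t]]\<close>: the radius is common to all coefficients.\<close>

definition holo_series :: "complex fps fps set" where
  "holo_series = {u. \<exists>r>0. \<exists>a. represents r a u}"

text \<open>\<open>\<O>{t}\<^sub>k\<^sub>,\<^sub>d\<close>\<close>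

definition holo_summable :: "real \<Rightarrow> real \<Rightarrow> complex fps fps set" where
  "holo_summable k d =
     {u. \<exists>r>0. \<exists>a. represents r a u \<and> k_summable (disc_space r) k d a}"

end

theory Submission
  imports Defs
begin

text \<open>
  On coefficients, the passage from \<open>u\<close> to \<open>v\<close> multiplies the coefficient of \<open>t\<^sup>i z\<^sup>j\<close> by
  \<open>m1 i * m2 j\<close>. This diagonal bijection of formal series carries the moment derivatives for
  \<open>m1 \<Gamma>\<^sub>s\<^sub>1\<close> and \<open>m2 \<Gamma>\<^sub>s\<^sub>2\<close> to those for \<open>\<Gamma>\<^sub>s\<^sub>1\<close> and \<open>\<Gamma>\<^sub>s\<^sub>2\<close>, because the factors \<open>m1\<close> and \<open>m2\<close>
  in the moment quotients telescope; so it carries formal solutions to formal solutions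
  (\<open>solves_cauchy_inverse_borel_iff\<close>). What needs analysis is that it respects the classes
  \<open>\<O>[[t]]\<close> and \<open>\<O>{t}\<^sub>k\<^sub>,\<^sub>d\<close>.

  If \<open>m\<close> preserves summability, so does its termwise inverse. It therefore suffices to show that
  the Borel operators of such an \<open>m\<close>, in \<open>t\<close> and in \<open>z\<close>, map each class into itself: the inverse
  operators are covered by the same statement.

  For the variable \<open>t\<close> and summable series this is the hypothesis on \<open>m\<close>, applied to the Banach
  space \<open>\<O>\<^sub>r\<close>.

  For the variable \<open>z\<close> the point is that \<open>1 / m n\<close> grows at most geometrically
  (\<open>preserves_summability_inverse_bound\<close>). Indeed \<open>\<Sum> (-1)\<^sup>n n! t\<^sup>n\<close> is 1-summable in the direction
  \<open>0\<close>, its Borel transform being \<open>1 / (1 + t)\<close>; hence its \<open>m\<close>-Borel transform is 1-summable too,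
  and in particular \<open>\<Sum> (-1)\<^sup>n t\<^sup>n / m n\<close> has a positive radius of convergence. By Cauchy's
  inequalities the \<open>m\<close>-Borel operator in \<open>z\<close> is then a bounded operator from \<open>\<O>\<^sub>r\<close> to a space
  \<open>\<O>\<^sub>\<rho>\<close> with smaller radius (\<open>bounded_operator_borel_disc\<close>), and bounded operators, applied to
  the coefficients, preserve \<open>k\<close>-summability (\<open>bounded_operator.k_summable_image\<close>).
\<close>

section \<open>The Banach spaces of functions on closed discs\<close>

lemma disc_space_sel [simp]:
  "add (disc_space r) = (\<lambda>f g z. f z + g z)"
  "zero (disc_space r) = (\<lambda>z. 0)"
  "smult (disc_space r) = (\<lambda>c f z. c * f z)"
  "vnorm (disc_space r) = (\<lambda>f. SUP z\<in>cball 0 r. cmod (f z))"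
  by (simp_all add: disc_space_def)

lemma in_disc_space_iff:
  "f \<in> carrier (disc_space r) \<longleftrightarrow>
     continuous_on (cball 0 r) f \<and> f holomorphic_on ball 0 r \<and> (\<forall>z. z \<notin> cball 0 r \<longrightarrow> f z = 0)"
  by (simp add: disc_space_def)

lemma disc_space_restrictI:
  assumes "continuous_on (cball 0 r) g" "g holomorphic_on ball 0 r"
  shows "(\<lambda>z. if z \<in> cball 0 r then g z else 0) \<in> carrier (disc_space r)"
  unfolding in_disc_space_iff
proof (intro conjI allI impI)
  show "continuous_on (cball 0 r) (\<lambda>z. if z \<in> cball 0 r then g z else 0)"
    using assms(1) by (rule continuous_on_eq) simp
  show "(\<lambda>z. if z \<in> cball 0 r then g z else 0) holomorphic_on ball 0 r"
    using assms(2) by (rule holomorphic_transform) simp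
qed simp

lemma disc_space_add_closed:
  "f \<in> carrier (disc_space r) \<Longrightarrow> g \<in> carrier (disc_space r) \<Longrightarrow>
     (\<lambda>z. f z + g z) \<in> carrier (disc_space r)"
  by (auto simp: in_disc_space_iff intro!: continuous_intros holomorphic_intros)

lemma disc_space_cmult_closed:
  "f \<in> carrier (disc_space r) \<Longrightarrow> (\<lambda>z. c * f z) \<in> carrier (disc_space r)"
  by (auto simp: in_disc_space_iff intro!: continuous_intros holomorphic_intros)

lemma cring_complex_ring: "cring complex_ring"
proof (rule cringI)
  show "abelian_group complex_ring"
  proof (rule abelian_groupI)
    fix x assume "x \<in> carrier complex_ring"
    show "\<exists>y\<in>carrier complex_ring. y \<oplus>\<^bsub>complex_ring\<^esub> x = \<zero>\<^bsub>complex_ring\<^esub>"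
      by (auto simp: complex_ring_def intro!: exI[of _ "-x"])
  qed (auto simp: complex_ring_def)
  show "comm_monoid complex_ring"
    by (rule comm_monoidI) (auto simp: complex_ring_def)
qed (auto simp: complex_ring_def algebra_simps)

lemma abelian_group_disc_space: "abelian_group (disc_space r)"
proof (rule abelian_groupI)
  fix f assume f: "f \<in> carrier (disc_space r)"
  show "\<exists>g\<in>carrier (disc_space r). g \<oplus>\<^bsub>disc_space r\<^esub> f = \<zero>\<^bsub>disc_space r\<^esub>"
    using disc_space_cmult_closed[OF f, of "-1"] by (intro bexI[of _ "\<lambda>z. - f z"]) auto
qed (auto simp: disc_space_add_closed algebra_simps, simp add: in_disc_space_iff)

lemma module_disc_space: "module complex_ring (disc_space r)"
  by (rule moduleI[OF cring_complex_ring abelian_group_disc_space])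
     (auto simp: disc_space_cmult_closed complex_ring_def algebra_simps)

lemma disc_space_minus:
  assumes "f \<in> carrier (disc_space r)" "g \<in> carrier (disc_space r)"
  shows "f \<ominus>\<^bsub>disc_space r\<^esub> g = (\<lambda>z. f z - g z)"
proof -
  interpret abelian_group "disc_space r" by (rule abelian_group_disc_space)
  have "\<ominus>\<^bsub>disc_space r\<^esub> g = (\<lambda>z. - g z)"
    using assms disc_space_cmult_closed[OF assms(2), of "-1"] by (intro minus_equality) auto
  thus ?thesis by (simp add: a_minus_def)
qed

lemma disc_space_finsum:
  assumes "\<And>n. n \<in> A \<Longrightarrow> f n \<in> carrier (disc_space r)" "finite A"
  shows "finsum (disc_space r) f A = (\<lambda>z. \<Sum>n\<in>A. f n z)"
proof -
  interpret abelian_group "disc_space r" by (rule abelian_group_disc_space)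
  show ?thesis using assms(2,1)
    by (induction A rule: finite_induct) (auto simp: finsum_insert Pi_def)
qed

lemma disc_space_bounded:
  assumes "f \<in> carrier (disc_space r)"
  shows "bdd_above ((\<lambda>z. cmod (f z)) ` cball 0 r)"
proof -
  have "compact ((\<lambda>z. cmod (f z)) ` cball 0 r)"
    using assms by (intro compact_continuous_image continuous_intros) (auto simp: in_disc_space_iff)
  thus ?thesis by (simp add: compact_imp_bounded bounded_imp_bdd_above)
qed

lemma cmod_le_disc_norm:
  assumes "f \<in> carrier (disc_space r)" "r > 0"
  shows "cmod (f z) \<le> vnorm (disc_space r) f"
proof (cases "z \<in> cball 0 r")
  case True
  thus ?thesis using disc_space_bounded[OF assms(1)] by (auto intro: cSUP_upper)
next
  case False
  have "0 \<le> cmod (f 0)" by simp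
  also have "\<dots> \<le> vnorm (disc_space r) f"
    using disc_space_bounded[OF assms(1)] assms(2) by (auto intro!: cSUP_upper)
  finally show ?thesis using False assms(1) by (simp add: in_disc_space_iff)
qed

lemma disc_norm_le:
  assumes "r > 0" "\<And>z. cmod z \<le> r \<Longrightarrow> cmod (f z) \<le> C"
  shows "vnorm (disc_space r) f \<le> C"
  using assms by (auto intro!: cSUP_least)

text \<open>
  A Cauchy sequence for the supremum norm converges uniformly on
  the closed disc, and uniform limits inherit continuity and holomorphy.
\<close>

lemma disc_space_complete:
  assumes r: "r > 0" and \<sigma>: "\<And>i. \<sigma> i \<in> carrier (disc_space r)"
    and Cauchy: "\<And>\<epsilon>. \<epsilon> > 0 \<Longrightarrow>
      \<exists>N. \<forall>i\<ge>N. \<forall>j\<ge>N. vnorm (disc_space r) (\<sigma> i \<ominus>\<^bsub>disc_space r\<^esub> \<sigma> j) < \<epsilon>"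
  shows "\<exists>l\<in>carrier (disc_space r).
           (\<lambda>i. vnorm (disc_space r) (\<sigma> i \<ominus>\<^bsub>disc_space r\<^esub> l)) \<longlonglongrightarrow> 0"
proof -
  interpret abelian_group "disc_space r" by (rule abelian_group_disc_space)
  have "uniformly_Cauchy_on (cball 0 r) \<sigma>"
    unfolding uniformly_Cauchy_on_def
  proof safe
    fix \<epsilon> :: real assume "\<epsilon> > 0"
    from Cauchy[OF this] obtain N where
      N: "\<And>i j. i \<ge> N \<Longrightarrow> j \<ge> N \<Longrightarrow> vnorm (disc_space r) (\<sigma> i \<ominus>\<^bsub>disc_space r\<^esub> \<sigma> j) < \<epsilon>" by blast
    have "dist (\<sigma> i z) (\<sigma> j z) < \<epsilon>" if "i \<ge> N" "j \<ge> N" for i j z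
      using cmod_le_disc_norm[OF minus_closed[OF \<sigma>[of i] \<sigma>[of j]] r, of z] N[OF that]
      by (simp add: disc_space_minus \<sigma> dist_norm del: disc_space_sel)
    thus "\<exists>M. \<forall>z\<in>cball 0 r. \<forall>i\<ge>M. \<forall>j\<ge>M. dist (\<sigma> i z) (\<sigma> j z) < \<epsilon>" by blast
  qed
  then obtain g where g: "uniform_limit (cball 0 r) \<sigma> g sequentially"
    using Cauchy_uniformly_convergent uniformly_convergent_on_def by blast
  have "continuous_on (cball 0 r) g \<and> g holomorphic_on ball 0 r"
    by (rule holomorphic_uniform_limit[OF _ g]) (use \<sigma> in \<open>auto simp: in_disc_space_iff\<close>)
  moreover define l where "l = (\<lambda>z. if z \<in> cball 0 r then g z else 0)"
  ultimately have l: "l \<in> carrier (disc_space r)" by (simp only: l_def disc_space_restrictI)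
  have "(\<lambda>i. vnorm (disc_space r) (\<sigma> i \<ominus>\<^bsub>disc_space r\<^esub> l)) \<longlonglongrightarrow> 0"
  proof (rule LIMSEQ_I)
    fix \<epsilon> :: real assume e: "\<epsilon> > 0"
    then obtain N where N: "\<And>i z. i \<ge> N \<Longrightarrow> z \<in> cball 0 r \<Longrightarrow> dist (\<sigma> i z) (g z) < \<epsilon> / 2"
      using g unfolding uniform_limit_iff eventually_sequentially by (meson half_gt_zero)
    have "norm (vnorm (disc_space r) (\<sigma> i \<ominus>\<^bsub>disc_space r\<^esub> l) - 0) < \<epsilon>" if i: "i \<ge> N" for i
    proof -
      have "vnorm (disc_space r) (\<sigma> i \<ominus>\<^bsub>disc_space r\<^esub> l) \<le> \<epsilon> / 2"
      proof (rule disc_norm_le[OF r])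
        fix z :: complex assume "cmod z \<le> r"
        thus "cmod ((\<sigma> i \<ominus>\<^bsub>disc_space r\<^esub> l) z) \<le> \<epsilon> / 2"
          using N[OF i, of z] unfolding disc_space_minus[OF \<sigma> l] by (simp add: dist_norm l_def)
      qed
      moreover have "0 \<le> vnorm (disc_space r) (\<sigma> i \<ominus>\<^bsub>disc_space r\<^esub> l)"
        using cmod_le_disc_norm[OF minus_closed[OF \<sigma>[of i] l] r, of 0] norm_ge_zero order_trans
        by blast
      ultimately show ?thesis using e by (simp del: disc_space_sel)
    qed
    thus "\<exists>no. \<forall>n\<ge>no. norm (vnorm (disc_space r) (\<sigma> n \<ominus>\<^bsub>disc_space r\<^esub> l) - 0) < \<epsilon>" by blast
  qed
  with l show ?thesis by blast
qed

lemma complex_banach_disc_space: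
  assumes r: "r > 0"
  shows "complex_banach (disc_space r)"
  unfolding complex_banach_def
proof (intro conjI ballI allI impI)
  show "module complex_ring (disc_space r)" by (rule module_disc_space)
next
  fix f assume f: "f \<in> carrier (disc_space r)"
  show "0 \<le> vnorm (disc_space r) f"
    using cmod_le_disc_norm[OF f r, of 0] norm_ge_zero order_trans by blast
  show "vnorm (disc_space r) f = 0 \<longleftrightarrow> f = \<zero>\<^bsub>disc_space r\<^esub>"
  proof
    assume "vnorm (disc_space r) f = 0"
    thus "f = \<zero>\<^bsub>disc_space r\<^esub>" using cmod_le_disc_norm[OF f r] by auto
  next
    assume "f = \<zero>\<^bsub>disc_space r\<^esub>"
    thus "vnorm (disc_space r) f = 0" using r by simp
  qed
next
  fix c f assume f: "f \<in> carrier (disc_space r)"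
  have le: "vnorm (disc_space r) (c \<odot>\<^bsub>disc_space r\<^esub> f) \<le> cmod c * vnorm (disc_space r) f"
    if f: "f \<in> carrier (disc_space r)" for c f
    by (rule disc_norm_le[OF r])
       (use cmod_le_disc_norm[OF f r] in \<open>auto simp: norm_mult intro: mult_left_mono\<close>)
  show "vnorm (disc_space r) (c \<odot>\<^bsub>disc_space r\<^esub> f) = cmod c * vnorm (disc_space r) f"
  proof (cases "c = 0")
    case True
    thus ?thesis using r by simp
  next
    case False
    \<comment> \<open>The reverse inequality is the same estimate for multiplication by the inverse of \<open>c\<close>.\<close>
    have "vnorm (disc_space r) f =
        vnorm (disc_space r) (inverse c \<odot>\<^bsub>disc_space r\<^esub> (c \<odot>\<^bsub>disc_space r\<^esub> f))"
      using False by (simp add: mult.assoc[symmetric])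
    also have "\<dots> \<le> cmod (inverse c) * vnorm (disc_space r) (c \<odot>\<^bsub>disc_space r\<^esub> f)"
      by (rule le) (simp add: disc_space_cmult_closed f)
    finally have "cmod c * vnorm (disc_space r) f \<le> vnorm (disc_space r) (c \<odot>\<^bsub>disc_space r\<^esub> f)"
      using False by (simp add: norm_divide field_simps del: disc_space_sel)
    with le[OF f, of c] show ?thesis by linarith
  qed
next
  fix f g assume f: "f \<in> carrier (disc_space r)" and g: "g \<in> carrier (disc_space r)"
  show "vnorm (disc_space r) (f \<oplus>\<^bsub>disc_space r\<^esub> g) \<le> vnorm (disc_space r) f + vnorm (disc_space r) g"
  proof (rule disc_norm_le[OF r])
    fix z :: complex
    show "cmod ((f \<oplus>\<^bsub>disc_space r\<^esub> g) z) \<le> vnorm (disc_space r) f + vnorm (disc_space r) g"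
      using norm_triangle_ineq[of "f z" "g z"] cmod_le_disc_norm[OF f r, of z]
        cmod_le_disc_norm[OF g r, of z] by (simp del: disc_space_sel(4))
  qed
next
  fix \<sigma> :: "nat \<Rightarrow> complex \<Rightarrow> complex"
  assume "range \<sigma> \<subseteq> carrier (disc_space r)"
    and "\<forall>\<epsilon>>0. \<exists>N. \<forall>i\<ge>N. \<forall>j\<ge>N. vnorm (disc_space r) (\<sigma> i \<ominus>\<^bsub>disc_space r\<^esub> \<sigma> j) < \<epsilon>"
  thus "\<exists>l\<in>carrier (disc_space r). (\<lambda>i. vnorm (disc_space r) (\<sigma> i \<ominus>\<^bsub>disc_space r\<^esub> l)) \<longlonglongrightarrow> 0"
    by (intro disc_space_complete[OF r]) auto
qed

section \<open>Bounded linear operators preserve summability\<close>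

lemma vholomorphic_on_carrier: "vholomorphic_on E f U \<Longrightarrow> z \<in> U \<Longrightarrow> f z \<in> carrier E"
  by (simp add: vholomorphic_on_def)

lemma exp_growth_holomorphic_D:
  assumes "exp_growth_holomorphic E k d \<alpha> r f g"
  shows "vholomorphic_on E f (ball 0 r)" "vholomorphic_on E g (sector d \<alpha>)"
    and "w \<in> sector d \<alpha> \<Longrightarrow> exp w \<in> ball 0 r \<Longrightarrow> g w = f (exp w)"
    and "0 < \<alpha>' \<Longrightarrow> \<alpha>' < \<alpha> \<Longrightarrow> 0 < r' \<Longrightarrow> r' < r \<Longrightarrow> \<exists>A>0. \<exists>B>0.
      (\<forall>t\<in>ball 0 r'. vnorm E (f t) < A * exp (B * cmod t powr k)) \<and>
      (\<forall>w\<in>sector d \<alpha>'. vnorm E (g w) < A * exp (B * cmod (exp w) powr k))"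
  using assms unfolding exp_growth_holomorphic_def by simp_all

locale bounded_operator =
  fixes E :: "('e, 'x) normed_module_scheme" and F :: "('f, 'y) normed_module_scheme"
    and T :: "'e \<Rightarrow> 'f" and C :: real
  assumes banach_dom: "complex_banach E" and banach_cod: "complex_banach F"
    and closed: "x \<in> carrier E \<Longrightarrow> T x \<in> carrier F"
    and add: "x \<in> carrier E \<Longrightarrow> y \<in> carrier E \<Longrightarrow> T (x \<oplus>\<^bsub>E\<^esub> y) = T x \<oplus>\<^bsub>F\<^esub> T y"
    and smult: "x \<in> carrier E \<Longrightarrow> T (c \<odot>\<^bsub>E\<^esub> x) = c \<odot>\<^bsub>F\<^esub> T x"
    and bound: "x \<in> carrier E \<Longrightarrow> vnorm F (T x) \<le> C * vnorm E x"
    and pos: "C > 0"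
begin

lemma modules: "module complex_ring E" "module complex_ring F"
  using banach_dom banach_cod by (auto simp: complex_banach_def)

sublocale E: module complex_ring E by (rule modules)
sublocale F: module complex_ring F by (rule modules)

lemma smult_closed: "x \<in> carrier E \<Longrightarrow> c \<odot>\<^bsub>E\<^esub> x \<in> carrier E"
  using E.smult_closed[of c x] by (simp add: complex_ring_def)

lemma zero: "T \<zero>\<^bsub>E\<^esub> = \<zero>\<^bsub>F\<^esub>"
  using add[of "\<zero>\<^bsub>E\<^esub>" "\<zero>\<^bsub>E\<^esub>"] closed[of "\<zero>\<^bsub>E\<^esub>"] by (simp add: F.add.l_cancel_one')

lemma minus:
  assumes "x \<in> carrier E" "y \<in> carrier E"
  shows "T (x \<ominus>\<^bsub>E\<^esub> y) = T x \<ominus>\<^bsub>F\<^esub> T y"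
proof -
  have "T (\<ominus>\<^bsub>E\<^esub> y) = \<ominus>\<^bsub>F\<^esub> T y"
    using add[of "\<ominus>\<^bsub>E\<^esub> y" y] assms
    by (intro F.minus_equality[symmetric]) (auto simp: E.l_neg zero closed)
  thus ?thesis using assms by (simp add: a_minus_def add)
qed

lemma finsum:
  assumes "finite A" "\<And>n. n \<in> A \<Longrightarrow> f n \<in> carrier E"
  shows "T (finsum E f A) = finsum F (\<lambda>n. T (f n)) A"
  using assms
proof (induction A rule: finite_induct)
  case empty
  show ?case by (simp add: zero)
next
  case (insert n A)
  hence "finsum E f (insert n A) = f n \<oplus>\<^bsub>E\<^esub> finsum E f A"
    and "finsum F (\<lambda>n. T (f n)) (insert n A) = T (f n) \<oplus>\<^bsub>F\<^esub> finsum F (\<lambda>n. T (f n)) A"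
    by (auto simp: E.finsum_insert F.finsum_insert Pi_def closed)
  thus ?case using insert by (simp add: add E.finsum_closed Pi_def)
qed

text \<open>
  Holomorphy and convergence of Borel transforms both say that the norm of an element of \<open>E\<close> built by
  linear operations tends to \<open>0\<close>. Such statements are transported by \<open>T\<close>; that the element lies in
  the carrier may fail away from the limit, for instance for difference quotients with large steps.
\<close>

lemma tendsto_zero:
  assumes "((\<lambda>h. vnorm E (f h)) \<longlongrightarrow> 0) G" "eventually (\<lambda>h. f h \<in> carrier E \<and> g h = T (f h)) G"
  shows "((\<lambda>h. vnorm F (g h)) \<longlongrightarrow> 0) G"
proof (rule tendsto_sandwich[where f = "\<lambda>_. 0"])
  show "((\<lambda>h. C * vnorm E (f h)) \<longlongrightarrow> 0) G"
    using tendsto_mult_right_zero[OF assms(1)] by simp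
  show "eventually (\<lambda>h. 0 \<le> vnorm F (g h)) G"
    using assms(2)
  proof eventually_elim
    case (elim h)
    thus ?case using banach_cod closed[of "f h"] by (simp add: complex_banach_def)
  qed
  show "eventually (\<lambda>h. vnorm F (g h) \<le> C * vnorm E (f h)) G"
    using assms(2) by eventually_elim (use bound in auto)
qed auto

lemma vholomorphic_on_image:
  assumes "vholomorphic_on E f U" "open U"
  shows "vholomorphic_on F (\<lambda>z. T (f z)) U"
  unfolding vholomorphic_on_def
proof (intro conjI ballI)
  fix z assume z: "z \<in> U"
  have f: "f y \<in> carrier E" if "y \<in> U" for y
    using assms(1) that by (rule vholomorphic_on_carrier)
  show "T (f z) \<in> carrier F" using f[OF z] closed by blast
  obtain f' where f': "f' \<in> carrier E"
    "((\<lambda>h. vnorm E ((1 / h) \<odot>\<^bsub>E\<^esub> (f (z + h) \<ominus>\<^bsub>E\<^esub> f z) \<ominus>\<^bsub>E\<^esub> f')) \<longlongrightarrow> 0) (at 0)"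
    using assms(1) z unfolding vholomorphic_on_def by blast
  have "open ((\<lambda>h. z + h) -` U)" using assms(2) by (intro open_vimage continuous_intros)
  hence "eventually (\<lambda>h. h \<in> (\<lambda>h. z + h) -` U) (at 0)"
    using z by (intro eventually_at_in_open') auto
  hence "eventually (\<lambda>h. (1 / h) \<odot>\<^bsub>E\<^esub> (f (z + h) \<ominus>\<^bsub>E\<^esub> f z) \<ominus>\<^bsub>E\<^esub> f' \<in> carrier E \<and>
      (1 / h) \<odot>\<^bsub>F\<^esub> (T (f (z + h)) \<ominus>\<^bsub>F\<^esub> T (f z)) \<ominus>\<^bsub>F\<^esub> T f' =
      T ((1 / h) \<odot>\<^bsub>E\<^esub> (f (z + h) \<ominus>\<^bsub>E\<^esub> f z) \<ominus>\<^bsub>E\<^esub> f')) (at 0)"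
    by eventually_elim (use f f' z in \<open>auto simp: minus smult smult_closed\<close>)
  from tendsto_zero[OF f'(2) this] show "\<exists>f'\<in>carrier F.
      ((\<lambda>h. vnorm F ((1 / h) \<odot>\<^bsub>F\<^esub> (T (f (z + h)) \<ominus>\<^bsub>F\<^esub> T (f z)) \<ominus>\<^bsub>F\<^esub> f')) \<longlongrightarrow> 0) (at 0)"
    using closed[OF f'(1)] by blast
qed

lemma exp_growth_holomorphic_image:
  assumes "exp_growth_holomorphic E k d \<alpha> r f g"
  shows "exp_growth_holomorphic F k d \<alpha> r (\<lambda>t. T (f t)) (\<lambda>w. T (g w))"
proof -
  have sector: "open (sector d \<alpha>)"
    unfolding sector_def by (intro open_Collect_less continuous_intros)
  note f = exp_growth_holomorphic_D(1)[OF assms] and g = exp_growth_holomorphic_D(2)[OF assms]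
  have scale: "vnorm F (T x) < C * A * b" if "x \<in> carrier E" "vnorm E x < A * b" for x A b
    using bound[OF that(1)] mult_strict_left_mono[OF that(2) pos] by (simp add: mult.assoc)
  have "\<exists>A>0. \<exists>B>0.
      (\<forall>t\<in>ball 0 r'. vnorm F (T (f t)) < A * exp (B * cmod t powr k)) \<and>
      (\<forall>w\<in>sector d \<alpha>'. vnorm F (T (g w)) < A * exp (B * cmod (exp w) powr k))"
    if *: "0 < \<alpha>' \<and> \<alpha>' < \<alpha> \<and> 0 < r' \<and> r' < r" for \<alpha>' r'
  proof -
    obtain A B where AB: "A > 0" "B > 0"
      "\<And>t. t \<in> ball 0 r' \<Longrightarrow> vnorm E (f t) < A * exp (B * cmod t powr k)"
      "\<And>w. w \<in> sector d \<alpha>' \<Longrightarrow> vnorm E (g w) < A * exp (B * cmod (exp w) powr k)"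
      using exp_growth_holomorphic_D(4)[OF assms, of \<alpha>' r'] * by blast
    have "f t \<in> carrier E" if "t \<in> ball 0 r'" for t
      using that * by (intro vholomorphic_on_carrier[OF f]) simp
    moreover have "g w \<in> carrier E" if "w \<in> sector d \<alpha>'" for w
      using that * by (intro vholomorphic_on_carrier[OF g]) (simp add: sector_def)
    ultimately have "\<forall>t\<in>ball 0 r'. vnorm F (T (f t)) < C * A * exp (B * cmod t powr k)"
      and "\<forall>w\<in>sector d \<alpha>'. vnorm F (T (g w)) < C * A * exp (B * cmod (exp w) powr k)"
      by (intro ballI scale AB(3,4); blast)+
    thus ?thesis using AB(1,2) pos by (intro exI[of _ "C * A"] conjI exI[of _ B]) simp_all
  qed
  moreover have "T (g w) = T (f (exp w))" if "w \<in> sector d \<alpha>" "exp w \<in> ball 0 r" for w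
    using exp_growth_holomorphic_D(3)[OF assms] that by simp
  ultimately show ?thesis
    using vholomorphic_on_image[OF f] vholomorphic_on_image[OF g sector]
    unfolding exp_growth_holomorphic_def by simp
qed

lemma k_summable_image:
  assumes "k_summable E k d a"
  shows "k_summable F k d (\<lambda>n. T (a n))"
proof -
  have a: "\<And>n. a n \<in> carrier E" using assms by (auto simp: k_summable_def)
  obtain \<alpha> r f g where *: "\<alpha> > 0" "r > 0" "exp_growth_holomorphic E k d \<alpha> r f g"
    and lim: "\<And>t. t \<in> ball 0 r \<Longrightarrow>
      (\<lambda>N. vnorm E ((\<Oplus>\<^bsub>E\<^esub>n\<in>{..<N}. t ^ n \<odot>\<^bsub>E\<^esub> vborel E (gamma_seq (1 / k)) a n) \<ominus>\<^bsub>E\<^esub> f t)) \<longlonglongrightarrow> 0"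
    using assms unfolding k_summable_def by blast
  have "(\<lambda>N. vnorm F ((\<Oplus>\<^bsub>F\<^esub>n\<in>{..<N}. t ^ n \<odot>\<^bsub>F\<^esub> vborel F (gamma_seq (1 / k)) (\<lambda>n. T (a n)) n)
            \<ominus>\<^bsub>F\<^esub> T (f t))) \<longlonglongrightarrow> 0" if t: "t \<in> ball 0 r" for t
  proof (rule tendsto_zero[OF lim[OF t]])
    have ft: "f t \<in> carrier E"
      using exp_growth_holomorphic_D(1)[OF *(3)] t by (rule vholomorphic_on_carrier)
    have s: "t ^ n \<odot>\<^bsub>E\<^esub> vborel E (gamma_seq (1 / k)) a n \<in> carrier E" for n
      using a by (simp add: vborel_def smult_closed)
    have "(\<Oplus>\<^bsub>F\<^esub>n\<in>{..<N}. t ^ n \<odot>\<^bsub>F\<^esub> vborel F (gamma_seq (1 / k)) (\<lambda>n. T (a n)) n) =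
        T (\<Oplus>\<^bsub>E\<^esub>n\<in>{..<N}. t ^ n \<odot>\<^bsub>E\<^esub> vborel E (gamma_seq (1 / k)) a n)" for N
      using s a by (subst finsum) (auto simp: vborel_def smult smult_closed)
    thus "\<forall>\<^sub>F N in sequentially.
        (\<Oplus>\<^bsub>E\<^esub>n\<in>{..<N}. t ^ n \<odot>\<^bsub>E\<^esub> vborel E (gamma_seq (1 / k)) a n) \<ominus>\<^bsub>E\<^esub> f t \<in> carrier E \<and>
        (\<Oplus>\<^bsub>F\<^esub>n\<in>{..<N}. t ^ n \<odot>\<^bsub>F\<^esub> vborel F (gamma_seq (1 / k)) (\<lambda>n. T (a n)) n) \<ominus>\<^bsub>F\<^esub> T (f t) =
        T ((\<Oplus>\<^bsub>E\<^esub>n\<in>{..<N}. t ^ n \<odot>\<^bsub>E\<^esub> vborel E (gamma_seq (1 / k)) a n) \<ominus>\<^bsub>E\<^esub> f t)"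
      using ft s by (intro always_eventually allI) (auto simp: minus E.finsum_closed)
  qed
  thus ?thesis
    using * exp_growth_holomorphic_image[OF *(3)] a closed unfolding k_summable_def by blast
qed

end

section \<open>Growth of sequences that preserve summability\<close>

text \<open>
  Every series \<open>a\<close> is the \<open>m\<close>-Borel transform of its own transform by the inverse sequence, so the
  equivalence for \<open>m\<close>, read backwards at that transform, is the equivalence for the inverse.
\<close>

lemma preserves_summability_inverse:
  assumes "preserves_summability m"
  shows "preserves_summability (\<lambda>n. inverse (m n))"
  unfolding preserves_summability_def preserves_summability_in_def
proof (intro conjI allI impI)
  have m: "m n > 0" "m 0 = 1" for n using assms by (auto simp: preserves_summability_def)
  show "0 < inverse (m n)" "inverse (m 0) = 1" for n using m by auto
  fix E :: "(complex \<Rightarrow> complex) normed_module" and k d :: real and a :: "nat \<Rightarrow> complex \<Rightarrow> complex"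
  assume E: "complex_banach E" and "k > 0" and a: "\<forall>n. a n \<in> carrier E"
  interpret module complex_ring E using E by (simp add: complex_banach_def)
  define b where "b = vborel E (\<lambda>n. inverse (m n)) a"
  have b: "b n \<in> carrier E" for n
    using a smult_closed[of _ "a n"] by (simp add: b_def vborel_def complex_ring_def)
  have "vborel E m b = a"
  proof
    fix n
    show "vborel E m b n = a n"
      using a smult_assoc1[of "1 / complex_of_real (m n)" "1 / complex_of_real (inverse (m n))" "a n"]
        m(1)[of n] smult_one[of "a n"] by (simp add: b_def vborel_def complex_ring_def)
  qed
  thus "k_summable E k d a \<longleftrightarrow> k_summable E k d (vborel E (\<lambda>n. inverse (m n)) a)"
    using assms E \<open>k > 0\<close> b
    by (auto simp: preserves_summability_def preserves_summability_in_def b_def[symmetric])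
qed

lemma preserves_summability_disc_space:
  assumes "preserves_summability m" "r > 0" "k > 0" "\<And>n. a n \<in> carrier (disc_space r)"
  shows "k_summable (disc_space r) k d (vborel (disc_space r) m a) \<longleftrightarrow> k_summable (disc_space r) k d a"
proof -
  have "preserves_summability_in (disc_space r) m"
    using assms(1) complex_banach_disc_space[OF assms(2)] unfolding preserves_summability_def by blast
  thus ?thesis using assms(3,4) unfolding preserves_summability_in_def by blast
qed

text \<open>
  Constant functions embed \<open>\<complex>\<close> isometrically into a disc space, so that scalar series can be used to
  test a sequence that preserves summability.
\<close>

definition disc_const :: "real \<Rightarrow> complex \<Rightarrow> complex \<Rightarrow> complex" where
  "disc_const r c = (\<lambda>z. if z \<in> cball 0 r then c else 0)"

lemma disc_const_in: "disc_const r c \<in> carrier (disc_space r)"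
  unfolding disc_const_def by (rule disc_space_restrictI) simp_all

lemma vnorm_disc_const: "r > 0 \<Longrightarrow> vnorm (disc_space r) (disc_const r c) = cmod c"
  by (simp add: disc_const_def)

lemma disc_const_minus:
  "disc_const r x \<ominus>\<^bsub>disc_space r\<^esub> disc_const r y = disc_const r (x - y)"
  by (subst disc_space_minus) (auto simp: disc_const_in, auto simp: disc_const_def)

lemma disc_const_smult: "c \<odot>\<^bsub>disc_space r\<^esub> disc_const r x = disc_const r (c * x)"
  by (auto simp: disc_const_def)

lemma disc_const_finsum:
  "finite A \<Longrightarrow> (\<Oplus>\<^bsub>disc_space r\<^esub>n\<in>A. disc_const r (x n)) = disc_const r (\<Sum>n\<in>A. x n)"
  by (subst disc_space_finsum) (auto simp: disc_const_in, auto simp: disc_const_def)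

lemma vholomorphic_on_disc_const:
  assumes "g holomorphic_on U" "open U" "r > 0"
  shows "vholomorphic_on (disc_space r) (\<lambda>z. disc_const r (g z)) U"
  unfolding vholomorphic_on_def
proof (intro conjI ballI)
  fix z assume "z \<in> U"
  then obtain g' where "(g has_field_derivative g') (at z)"
    using assms by (auto simp: holomorphic_on_open)
  hence "((\<lambda>h. (g (z + h) - g z) / h) \<longlongrightarrow> g') (at 0)" by (simp add: DERIV_def)
  hence "((\<lambda>h. cmod ((g (z + h) - g z) / h - g')) \<longlongrightarrow> 0) (at 0)"
    by (intro tendsto_norm_zero) (simp add: LIM_zero)
  thus "\<exists>f'\<in>carrier (disc_space r). ((\<lambda>h. vnorm (disc_space r) ((1 / h) \<odot>\<^bsub>disc_space r\<^esub>
      (disc_const r (g (z + h)) \<ominus>\<^bsub>disc_space r\<^esub> disc_const r (g z)) \<ominus>\<^bsub>disc_space r\<^esub> f')) \<longlongrightarrow> 0) (at 0)"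
    using assms(3)
    by (intro bexI[of _ "disc_const r g'"])
       (simp_all add: disc_const_minus disc_const_smult vnorm_disc_const disc_const_in del: disc_space_sel)
qed (rule disc_const_in)

lemma vborel_disc_const:
  "vborel (disc_space r) m (\<lambda>n. disc_const r (x n)) = (\<lambda>n. disc_const r (x n / m n))"
  by (simp add: fun_eq_iff vborel_def disc_const_smult[unfolded fun_eq_iff] del: disc_space_sel)

lemma gamma_seq_1: "gamma_seq (1 / 1) n = fact n"
  by (simp add: gamma_seq_def Gamma_fact)

text \<open>
  The Borel transform is \<open>1 / (1 + t)\<close>. On the sector of opening \<open>1\<close> around the positive axis
  \<open>Re t > 0\<close>, so \<open>|1 + t| > 1\<close>, and the transform is bounded by \<open>1\<close> there.
\<close>

lemma k_summable_alternating_factorials: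
  "k_summable (disc_space 1) 1 0 (\<lambda>n. disc_const 1 ((-1) ^ n * fact n))"
proof -
  define f where "f = (\<lambda>t. disc_const 1 (1 / (1 + t)))"
  define g where "g = (\<lambda>w. disc_const 1 (1 / (1 + exp w)))"
  have ball: "1 + t \<noteq> 0" "1 - r < cmod (1 + t)" if "t \<in> ball 0 r" "r \<le> 1" for t :: complex and r
    using that norm_triangle_ineq2[of 1 "-t"] by auto
  have sector: "1 \<le> cmod (1 + exp w)" if "w \<in> sector 0 1" for w
  proof -
    have "0 < cos (Im w)"
      using that pi_gt3 by (intro cos_gt_zero_pi) (auto simp: sector_def abs_if split: if_splits)
    hence "1 \<le> Re (1 + exp w)" by (simp add: Re_exp)
    thus ?thesis using complex_Re_le_cmod[of "1 + exp w"] by linarith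
  qed
  have grow: "exp_growth_holomorphic (disc_space 1) 1 0 1 1 f g"
    unfolding exp_growth_holomorphic_def
  proof (intro conjI allI impI)
    show "vholomorphic_on (disc_space 1) f (ball 0 1)" unfolding f_def
      using ball(1)[of _ 1] by (intro vholomorphic_on_disc_const holomorphic_intros) auto
    show "vholomorphic_on (disc_space 1) g (sector 0 1)" unfolding g_def
    proof (intro vholomorphic_on_disc_const holomorphic_intros)
      show "open (sector 0 1)" unfolding sector_def by (intro open_Collect_less continuous_intros)
    qed (use sector in force)+
    show "\<forall>w\<in>sector 0 1. exp w \<in> ball 0 1 \<longrightarrow> g w = f (exp w)" by (simp add: f_def g_def)
    fix \<alpha>' r' :: real assume *: "0 < \<alpha>' \<and> \<alpha>' < 1 \<and> 0 < r' \<and> r' < 1"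
    define A where "A = 1 / (1 - r') + 1"
    have A: "A > 1" "A > 1 / (1 - r')" using * by (auto simp: A_def)
    have up: "x < A * exp (1 * y powr 1)" if "x < A" "0 \<le> y" for x y
    proof -
      have "A * 1 \<le> A * exp (1 * y powr 1)" using A by (intro mult_left_mono) auto
      thus ?thesis using that by simp
    qed
    have "vnorm (disc_space 1) (f t) < A" if "t \<in> ball 0 r'" for t
    proof -
      have "1 / cmod (1 + t) \<le> 1 / (1 - r')"
        using ball(2)[OF that] * by (intro divide_left_mono mult_pos_pos) auto
      thus ?thesis using A by (simp add: f_def vnorm_disc_const norm_divide del: disc_space_sel)
    qed
    moreover have "vnorm (disc_space 1) (g w) < A" if "w \<in> sector 0 \<alpha>'" for w
    proof -
      have "1 \<le> cmod (1 + exp w)" using that * by (intro sector) (auto simp: sector_def)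
      hence "1 / cmod (1 + exp w) \<le> 1" by (simp add: divide_le_eq)
      thus ?thesis using A by (simp add: g_def vnorm_disc_const norm_divide del: disc_space_sel)
    qed
    ultimately show "\<exists>A>0. \<exists>B>0.
        (\<forall>t\<in>ball 0 r'. vnorm (disc_space 1) (f t) < A * exp (B * cmod t powr 1)) \<and>
        (\<forall>w\<in>sector 0 \<alpha>'. vnorm (disc_space 1) (g w) < A * exp (B * cmod (exp w) powr 1))"
      using A up by (intro exI[of _ A] conjI exI[of _ 1] ballI) (auto simp del: disc_space_sel)
  qed
  have lim: "(\<lambda>N. vnorm (disc_space 1) ((\<Oplus>\<^bsub>disc_space 1\<^esub>n\<in>{..<N}. t ^ n \<odot>\<^bsub>disc_space 1\<^esub>
      vborel (disc_space 1) (gamma_seq (1 / 1)) (\<lambda>n. disc_const 1 ((-1) ^ n * fact n)) n)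
      \<ominus>\<^bsub>disc_space 1\<^esub> f t)) \<longlonglongrightarrow> 0" if t: "t \<in> ball 0 1" for t
  proof -
    have "(\<lambda>n. (- t) ^ n) sums (1 / (1 - (- t)))" using t by (intro geometric_sums) simp
    hence "(\<lambda>N. (\<Sum>n<N. (- t) ^ n) - 1 / (1 + t)) \<longlonglongrightarrow> 0"
      unfolding sums_def by (simp add: LIM_zero)
    moreover have "t ^ n * ((-1) ^ n * fact n / fact n) = (- t) ^ n" for n
      by (simp add: power_minus[of t] mult.commute)
    ultimately show ?thesis unfolding vborel_disc_const gamma_seq_1 disc_const_smult f_def
      by (simp add: disc_const_finsum disc_const_minus vnorm_disc_const tendsto_norm_zero
          del: disc_space_sel)
  qed
  show ?thesis
    unfolding k_summable_def using grow lim zero_less_one disc_const_in by blast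
qed

text \<open>
  The factor \<open>n!\<close> is removed by the Borel operator of order \<open>1\<close>, and the remaining series converges
  near \<open>0\<close>; evaluating the elements of the disc space at \<open>z = 0\<close> gives convergence of numbers.
\<close>

lemma k_summable_disc_const_coeff_bound:
  assumes "k_summable (disc_space 1) 1 d (\<lambda>n. disc_const 1 (c n * fact n))"
  shows "\<exists>C q. \<forall>n. cmod (c n) \<le> C * q ^ n"
proof -
  obtain \<alpha> r f g where r: "r > 0" and E: "exp_growth_holomorphic (disc_space 1) 1 d \<alpha> r f g"
    and lim: "\<And>t. t \<in> ball 0 r \<Longrightarrow>
      (\<lambda>N. vnorm (disc_space 1) ((\<Oplus>\<^bsub>disc_space 1\<^esub>n\<in>{..<N}. t ^ n \<odot>\<^bsub>disc_space 1\<^esub>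
      vborel (disc_space 1) (gamma_seq (1 / 1)) (\<lambda>n. disc_const 1 (c n * fact n)) n)
      \<ominus>\<^bsub>disc_space 1\<^esub> f t)) \<longlonglongrightarrow> 0"
    using assms unfolding k_summable_def by blast
  define t where "t = complex_of_real (r / 2)"
  have t: "t \<in> ball 0 r" using r by (simp add: t_def)
  have ft: "f t \<in> carrier (disc_space 1)"
    using exp_growth_holomorphic_D(1)[OF E] t by (rule vholomorphic_on_carrier)
  interpret abelian_group "disc_space 1" by (rule abelian_group_disc_space)
  define S where "S = (\<lambda>N. \<Sum>n<N. t ^ n * c n)"
  have lim_norm: "(\<lambda>N. vnorm (disc_space 1) (disc_const 1 (S N) \<ominus>\<^bsub>disc_space 1\<^esub> f t)) \<longlonglongrightarrow> 0"
    using lim[OF t] unfolding vborel_disc_const gamma_seq_1 disc_const_smult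
    by (simp add: disc_const_finsum S_def del: disc_space_sel)
  have le: "\<forall>N. norm (S N - f t 0) \<le> vnorm (disc_space 1) (disc_const 1 (S N) \<ominus>\<^bsub>disc_space 1\<^esub> f t)"
  proof
    fix N
    show "norm (S N - f t 0) \<le> vnorm (disc_space 1) (disc_const 1 (S N) \<ominus>\<^bsub>disc_space 1\<^esub> f t)"
      using cmod_le_disc_norm[OF minus_closed[OF disc_const_in ft], of "S N" 0]
      by (simp only: disc_space_minus[OF disc_const_in ft]) (simp add: disc_const_def)
  qed
  have "(\<lambda>N. S N - f t 0) \<longlonglongrightarrow> 0"
    by (rule Lim_null_comparison[OF always_eventually[OF le] lim_norm])
  hence "(\<lambda>n. t ^ n * c n) sums f t 0" by (simp add: sums_def S_def LIM_zero_cancel)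
  hence "Bseq (\<lambda>n. t ^ n * c n)"
    by (intro convergent_imp_Bseq convergentI[OF summable_LIMSEQ_zero] sums_summable)
  then obtain C where C: "\<And>n. cmod (t ^ n * c n) \<le> C" unfolding Bseq_def by blast
  have "cmod (c n) \<le> C * (2 / r) ^ n" for n
  proof -
    have "cmod (t ^ n * c n) = (r / 2) ^ n * cmod (c n)"
      unfolding norm_mult norm_power t_def norm_of_real using r by simp
    hence "(r / 2) ^ n * cmod (c n) \<le> C" using C[of n] by simp
    thus ?thesis using r by (simp add: power_divide field_simps)
  qed
  thus ?thesis by blast
qed

lemma preserves_summability_inverse_bound:
  assumes "preserves_summability m"
  shows "\<exists>K\<ge>1. \<forall>n. inverse (m n) \<le> K ^ n"
proof -
  have m: "m n > 0" "m 0 = 1" for n using assms by (auto simp: preserves_summability_def)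
  have "k_summable (disc_space 1) 1 0 (vborel (disc_space 1) m (\<lambda>n. disc_const 1 ((-1) ^ n * fact n)))"
    by (subst preserves_summability_disc_space[OF assms])
       (simp_all add: k_summable_alternating_factorials disc_const_in)
  hence "k_summable (disc_space 1) 1 0 (\<lambda>n. disc_const 1 ((-1) ^ n / complex_of_real (m n) * fact n))"
    unfolding vborel_disc_const by simp
  then obtain C q where "\<And>n. cmod ((-1) ^ n / complex_of_real (m n)) \<le> C * q ^ n"
    using k_summable_disc_const_coeff_bound[of 0 "\<lambda>n. (-1) ^ n / complex_of_real (m n)"] by blast
  moreover have "cmod ((-1) ^ n / complex_of_real (m n)) = inverse (m n)" for n
    using m(1)[of n] by (simp add: norm_mult norm_inverse norm_power divide_inverse)
  ultimately have Cq: "inverse (m n) \<le> C * q ^ n" for n by metis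
  have C: "1 \<le> C" using Cq[of 0] m(2) by simp
  define q' where "q' = max 1 \<bar>q\<bar>"
  have q': "1 \<le> q'" "\<bar>q\<bar> \<le> q'" by (simp_all add: q'_def)
  \<comment> \<open>Since \<open>m 0 = 1\<close>, the constant factor \<open>C\<close> can be absorbed into the base.\<close>
  have "inverse (m n) \<le> (C * q') ^ n" for n
  proof (cases "n = 0")
    case True
    thus ?thesis by (simp add: m(2))
  next
    case False
    have "q ^ n \<le> \<bar>q\<bar> ^ n" by (metis abs_ge_self power_abs)
    also have "\<dots> \<le> q' ^ n" using q'(2) by (intro power_mono) simp_all
    finally have "C * q ^ n \<le> C * q' ^ n" using C by (intro mult_left_mono) simp_all
    also have "\<dots> \<le> C ^ n * q' ^ n"
      using self_le_power[OF C, of n] False q'(1) by (intro mult_right_mono) simp_all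
    finally show ?thesis using Cq[of n] by (simp add: power_mult_distrib)
  qed
  moreover have "1 * 1 \<le> C * q'" using C q'(1) by (intro mult_mono) simp_all
  ultimately show ?thesis by (intro exI[of _ "C * q'"]) simp
qed

section \<open>The Borel operator in \<open>z\<close> on disc spaces\<close>

text \<open>
  The restriction to the closed disc of radius \<open>\<rho>\<close>, extended by \<open>0\<close>, makes the sum of the transformed
  Taylor series an element of the disc space of radius \<open>\<rho>\<close>.
\<close>

definition borel_disc :: "(nat \<Rightarrow> real) \<Rightarrow> real \<Rightarrow> (complex \<Rightarrow> complex) \<Rightarrow> complex \<Rightarrow> complex" where
  "borel_disc m \<rho> f =
     (\<lambda>z. if z \<in> cball 0 \<rho> then eval_fps (borel_fps m (fps_expansion f 0)) z else 0)"

lemma disc_space_has_fps_expansion: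
  assumes "f \<in> carrier (disc_space r)" "r > 0"
  shows "f has_fps_expansion fps_expansion f 0"
  using assms by (intro has_fps_expansion_fps_expansion[of "ball 0 r"]) (auto simp: in_disc_space_iff)

text \<open>
  If \<open>1 / m n \<le> K\<^sup>n\<close>, the radius of convergence shrinks at most by the factor \<open>K\<close>. The disc is taken
  smaller by a further factor \<open>2\<close>, which leaves the terms of the series bounded by a geometric
  series of ratio \<open>1 / 2\<close>, uniformly on the closed disc, and gives the operator norm bound \<open>2\<close>.
\<close>

context
  fixes m :: "nat \<Rightarrow> real" and K r :: real
  assumes r: "r > 0" and K: "K \<ge> 1" and m_pos: "\<And>n. m n > 0"
    and m_bound: "\<And>n. inverse (m n) \<le> K ^ n"
begin

lemma borel_coeff_bound:
  assumes f: "f \<in> carrier (disc_space r)"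
  shows "cmod (fps_nth (borel_fps m (fps_expansion f 0)) n) \<le> vnorm (disc_space r) f * (K / r) ^ n"
proof -
  define V where "V = vnorm (disc_space r) f"
  have V: "cmod (f z) \<le> V" for z unfolding V_def by (rule cmod_le_disc_norm[OF f r])
  have "cmod ((deriv ^^ n) f 0) \<le> fact n * V / r ^ n"
    using f r V by (intro Cauchy_inequality) (simp_all add: in_disc_space_iff)
  hence "cmod ((deriv ^^ n) f 0) / fact n \<le> V / r ^ n" by (simp add: field_simps)
  moreover have "0 \<le> V" using V[of 0] norm_ge_zero order_trans by blast
  ultimately have "cmod ((deriv ^^ n) f 0) / fact n * inverse (m n) \<le> V / r ^ n * K ^ n"
    using m_bound[of n] m_pos[of n] r by (intro mult_mono) simp_all
  moreover have "cmod (fps_nth (borel_fps m (fps_expansion f 0)) n) =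
      cmod ((deriv ^^ n) f 0) / fact n * inverse (m n)"
    using m_pos[of n] by (simp add: borel_fps_def fps_expansion_def norm_mult norm_inverse divide_inverse)
  ultimately show ?thesis by (simp add: V_def[symmetric] power_divide del: disc_space_sel)
qed

lemma borel_conv_radius:
  assumes f: "f \<in> carrier (disc_space r)"
  shows "fps_conv_radius (borel_fps m (fps_expansion f 0)) \<ge> ereal (r / K)"
  unfolding fps_conv_radius_def
proof (rule conv_radius_geI_ex')
  fix \<rho> :: real assume \<rho>: "0 < \<rho>" "ereal \<rho> < ereal (r / K)"
  have "norm (K / r * \<rho>) < 1" using \<rho> r K by (simp add: field_simps)
  hence "summable (\<lambda>n. vnorm (disc_space r) f * (K / r * \<rho>) ^ n)"
    by (intro summable_mult summable_geometric)
  thus "summable (\<lambda>n. fps_nth (borel_fps m (fps_expansion f 0)) n * complex_of_real \<rho> ^ n)"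
  proof (rule summable_comparison_test'[where N = 0])
    fix n
    have "cmod (fps_nth (borel_fps m (fps_expansion f 0)) n) * \<rho> ^ n
        \<le> vnorm (disc_space r) f * (K / r) ^ n * \<rho> ^ n"
      using \<rho>(1) by (intro mult_right_mono borel_coeff_bound[OF f]) simp
    thus "cmod (fps_nth (borel_fps m (fps_expansion f 0)) n * complex_of_real \<rho> ^ n)
        \<le> vnorm (disc_space r) f * (K / r * \<rho>) ^ n"
      unfolding norm_mult norm_power norm_of_real power_mult_distrib using \<rho>(1)
      by (simp add: mult.assoc del: disc_space_sel)
  qed
qed

lemma borel_radius_less: "r / (2 * K) < r / K" "0 < r / (2 * K)"
proof -
  have "0 < r / K" using r K by simp
  moreover have "r / (2 * K) = r / K / 2" by simp
  ultimately show "r / (2 * K) < r / K" "0 < r / (2 * K)" by linarith+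
qed

lemma in_borel_convergence_disc:
  assumes "f \<in> carrier (disc_space r)" "cmod z \<le> r / (2 * K)"
  shows "ereal (cmod z) < fps_conv_radius (borel_fps m (fps_expansion f 0))"
proof -
  have "ereal (cmod z) < ereal (r / K)" using assms(2) borel_radius_less(1) by simp
  thus ?thesis using borel_conv_radius[OF assms(1)] by (rule less_le_trans)
qed

lemma borel_disc_closed:
  assumes f: "f \<in> carrier (disc_space r)"
  shows "borel_disc m (r / (2 * K)) f \<in> carrier (disc_space (r / (2 * K)))"
proof -
  have "eval_fps (borel_fps m (fps_expansion f 0)) holomorphic_on cball 0 (r / (2 * K))"
    using in_borel_convergence_disc[OF f] by (intro holomorphic_on_eval_fps) (simp add: in_eball_iff subset_iff)
  thus ?thesis unfolding borel_disc_def
    by (intro disc_space_restrictI holomorphic_on_imp_continuous_on)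
       (simp_all add: holomorphic_on_subset[OF _ ball_subset_cball])
qed

lemma fps_expansion_borel_disc:
  assumes f: "f \<in> carrier (disc_space r)"
  shows "fps_expansion (borel_disc m (r / (2 * K)) f) 0 = borel_fps m (fps_expansion f 0)"
proof (rule fps_expansion_eqI)
  have "eventually (\<lambda>z. z \<in> ball 0 (r / (2 * K))) (nhds (0 :: complex))"
    using borel_radius_less by (intro eventually_nhds_in_open) auto
  hence "eventually (\<lambda>z. borel_disc m (r / (2 * K)) f z = eval_fps (borel_fps m (fps_expansion f 0)) z)
      (nhds 0)"
    by eventually_elim (auto simp: borel_disc_def)
  moreover have "fps_conv_radius (borel_fps m (fps_expansion f 0)) > 0"
    using in_borel_convergence_disc[OF f, of 0] borel_radius_less by (simp add: zero_ereal_def)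
  ultimately show "borel_disc m (r / (2 * K)) f has_fps_expansion borel_fps m (fps_expansion f 0)"
    using eval_fps_has_fps_expansion has_fps_expansion_cong by blast
qed

lemma borel_disc_bound:
  assumes f: "f \<in> carrier (disc_space r)"
  shows "vnorm (disc_space (r / (2 * K))) (borel_disc m (r / (2 * K)) f) \<le> 2 * vnorm (disc_space r) f"
proof (rule disc_norm_le[OF borel_radius_less(2)])
  fix z :: complex assume z: "cmod z \<le> r / (2 * K)"
  define V where "V = vnorm (disc_space r) f"
  have V: "V \<ge> 0" using cmod_le_disc_norm[OF f r, of 0] norm_ge_zero order_trans unfolding V_def by blast
  have "cmod (fps_nth (borel_fps m (fps_expansion f 0)) n * z ^ n) \<le> V * (1 / 2) ^ n" for n
  proof -
    have "cmod (fps_nth (borel_fps m (fps_expansion f 0)) n * z ^ n)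
        \<le> V * (K / r) ^ n * (r / (2 * K)) ^ n"
      unfolding norm_mult norm_power V_def using z V r K
      by (intro mult_mono borel_coeff_bound[OF f] power_mono) (auto simp: V_def simp del: disc_space_sel)
    also have "\<dots> = V * (1 / 2) ^ n"
      using r K by (simp add: power_mult_distrib[symmetric] mult.assoc)
    finally show ?thesis .
  qed
  moreover have "(\<lambda>n. V * (1 / 2) ^ n) sums (V * (1 / (1 - 1 / 2)))"
    by (intro sums_mult geometric_sums) simp
  ultimately have "cmod (\<Sum>n. fps_nth (borel_fps m (fps_expansion f 0)) n * z ^ n) \<le> V * 2"
    using norm_suminf_le[of "\<lambda>n. fps_nth (borel_fps m (fps_expansion f 0)) n * z ^ n"
        "\<lambda>n. V * (1 / 2) ^ n"] by (simp add: sums_iff)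
  thus "cmod (borel_disc m (r / (2 * K)) f z) \<le> 2 * vnorm (disc_space r) f"
    using z by (simp add: borel_disc_def eval_fps_def V_def del: disc_space_sel)
qed

lemma bounded_operator_borel_disc:
  "bounded_operator (disc_space r) (disc_space (r / (2 * K))) (borel_disc m (r / (2 * K))) 2"
proof
  fix f assume f: "f \<in> carrier (disc_space r)"
  {
    fix g assume g: "g \<in> carrier (disc_space r)"
    have "fps_expansion (\<lambda>z. f z + g z) 0 = fps_expansion f 0 + fps_expansion g 0"
      using f g r by (intro fps_expansion_eqI has_fps_expansion_add disc_space_has_fps_expansion)
    hence "borel_fps m (fps_expansion (\<lambda>z. f z + g z) 0) =
        borel_fps m (fps_expansion f 0) + borel_fps m (fps_expansion g 0)"
      by (simp add: borel_fps_def fps_eq_iff add_divide_distrib)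
    thus "borel_disc m (r / (2 * K)) (f \<oplus>\<^bsub>disc_space r\<^esub> g) =
        borel_disc m (r / (2 * K)) f \<oplus>\<^bsub>disc_space (r / (2 * K))\<^esub> borel_disc m (r / (2 * K)) g"
      using in_borel_convergence_disc[OF f] in_borel_convergence_disc[OF g]
      by (auto simp: borel_disc_def eval_fps_add)
  }
  fix c
  have "fps_expansion (\<lambda>z. c * f z) 0 = fps_const c * fps_expansion f 0"
    using f r by (intro fps_expansion_eqI has_fps_expansion_cmult_left disc_space_has_fps_expansion)
  hence "borel_fps m (fps_expansion (\<lambda>z. c * f z) 0) = fps_const c * borel_fps m (fps_expansion f 0)"
    by (simp add: borel_fps_def fps_eq_iff)
  thus "borel_disc m (r / (2 * K)) (c \<odot>\<^bsub>disc_space r\<^esub> f) =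
      c \<odot>\<^bsub>disc_space (r / (2 * K))\<^esub> borel_disc m (r / (2 * K)) f"
    using in_borel_convergence_disc[OF f]
    by (auto simp: borel_disc_def eval_fps_mult)
qed (use complex_banach_disc_space r borel_radius_less borel_disc_closed borel_disc_bound in auto)

lemma represents_borel_disc:
  "represents r a u \<Longrightarrow> represents (r / (2 * K)) (\<lambda>n. borel_disc m (r / (2 * K)) (a n)) (borel_z m u)"
  using borel_disc_closed fps_expansion_borel_disc by (simp add: represents_def borel_z_def)

end

section \<open>Borel operators on holomorphic and on summable series\<close>

text \<open>
  The Borel operator in \<open>t\<close> only rescales the coefficients, so it keeps the radius. The one in \<open>z\<close>
  shrinks it, by a factor that is the same for all coefficients.
\<close>

lemma represents_vborel:
  assumes "r > 0" "represents r a u"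
  shows "represents r (vborel (disc_space r) m a) (borel_t m u)"
  unfolding represents_def
proof (intro allI conjI)
  fix n
  have a: "a n \<in> carrier (disc_space r)" "fps_expansion (a n) 0 = fps_nth u n"
    using assms by (auto simp: represents_def)
  show "vborel (disc_space r) m a n \<in> carrier (disc_space r)"
    unfolding vborel_def disc_space_sel by (rule disc_space_cmult_closed[OF a(1)])
  show "fps_expansion (vborel (disc_space r) m a n) 0 = fps_nth (borel_t m u) n"
    unfolding vborel_def borel_t_def disc_space_sel fps_nth_Abs_fps a(2)[symmetric]
    by (intro fps_expansion_eqI has_fps_expansion_cmult_left disc_space_has_fps_expansion[OF a(1) assms(1)])
qed

lemma borel_t_holo_series:
  assumes "u \<in> holo_series"
  shows "borel_t m u \<in> holo_series"
  using assms represents_vborel unfolding holo_series_def by blast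

lemma borel_t_holo_summable:
  assumes "preserves_summability m" "k > 0" "u \<in> holo_summable k d"
  shows "borel_t m u \<in> holo_summable k d"
proof -
  obtain r a where ra: "r > 0" "represents r a u" "k_summable (disc_space r) k d a"
    using assms(3) by (auto simp: holo_summable_def)
  have "k_summable (disc_space r) k d (vborel (disc_space r) m a)"
    using ra(2,3) by (subst preserves_summability_disc_space[OF assms(1) ra(1) assms(2)])
      (auto simp: represents_def)
  thus ?thesis using ra(1) represents_vborel[OF ra(1,2)] by (auto simp: holo_summable_def)
qed

lemma borel_z_holo_series:
  assumes "preserves_summability m" "u \<in> holo_series"
  shows "borel_z m u \<in> holo_series"
proof -
  obtain r a where ra: "r > 0" "represents r a u" using assms(2) by (auto simp: holo_series_def)
  obtain K where K: "K \<ge> 1" "\<And>n. inverse (m n) \<le> K ^ n"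
    using preserves_summability_inverse_bound[OF assms(1)] by blast
  have m: "\<And>n. m n > 0" using assms(1) by (simp add: preserves_summability_def)
  show ?thesis
    using represents_borel_disc[OF ra(1) K(1) m K(2) ra(2)] borel_radius_less(2)[OF ra(1) K(1) m K(2)]
    by (auto simp: holo_series_def)
qed

lemma borel_z_holo_summable:
  assumes "preserves_summability m" "u \<in> holo_summable k d"
  shows "borel_z m u \<in> holo_summable k d"
proof -
  obtain r a where ra: "r > 0" "represents r a u" "k_summable (disc_space r) k d a"
    using assms(2) by (auto simp: holo_summable_def)
  obtain K where K: "K \<ge> 1" "\<And>n. inverse (m n) \<le> K ^ n"
    using preserves_summability_inverse_bound[OF assms(1)] by blast
  have m: "\<And>n. m n > 0" using assms(1) by (simp add: preserves_summability_def)
  interpret bounded_operator "disc_space r" "disc_space (r / (2 * K))" "borel_disc m (r / (2 * K))" 2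
    by (rule bounded_operator_borel_disc[OF ra(1) K(1) m K(2)])
  show ?thesis
    using represents_borel_disc[OF ra(1) K(1) m K(2) ra(2)] borel_radius_less(2)[OF ra(1) K(1) m K(2)]
      k_summable_image[OF ra(3)]
    unfolding holo_summable_def by blast
qed

section \<open>Intertwining of moment differential operators\<close>

text \<open>
  This operator strips the factors \<open>m1\<close> and \<open>m2\<close> from moment sequences \<open>m1 g1\<close> and \<open>m2 g2\<close>: it
  maps formal solutions of the equation for these to formal solutions for \<open>g1\<close> and \<open>g2\<close>.
\<close>

definition inverse_borel :: "(nat \<Rightarrow> real) \<Rightarrow> (nat \<Rightarrow> real) \<Rightarrow> complex fps fps \<Rightarrow> complex fps fps" where
  "inverse_borel m1 m2 u = borel_t (\<lambda>n. inverse (m1 n)) (borel_z (\<lambda>n. inverse (m2 n)) u)"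

lemma inverse_borel_nth:
  "fps_nth (fps_nth (inverse_borel m1 m2 u) i) j =
     complex_of_real (m1 i) * complex_of_real (m2 j) * fps_nth (fps_nth u i) j"
  by (simp add: inverse_borel_def borel_t_def borel_z_def borel_fps_def divide_inverse of_real_inverse[symmetric]
      del: of_real_inverse)

lemma borel_inverse_borel:
  assumes "\<And>n. m1 n \<noteq> 0" "\<And>n. m2 n \<noteq> 0"
  shows "borel_z m2 (borel_t m1 (inverse_borel m1 m2 u)) = u"
  using assms by (simp add: borel_t_def borel_z_def borel_fps_def fps_eq_iff inverse_borel_nth)

lemma inverse_borel_eq_0_iff:
  assumes "\<And>n. m1 n \<noteq> 0" "\<And>n. m2 n \<noteq> 0"
  shows "inverse_borel m1 m2 u = 0 \<longleftrightarrow> u = 0"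
  using assms by (simp add: fps_eq_iff inverse_borel_nth)

lemma inverse_borel_sum: "inverse_borel m1 m2 (\<Sum>i\<in>A. f i) = (\<Sum>i\<in>A. inverse_borel m1 m2 (f i))"
proof (induction A rule: infinite_finite_induct)
  case (insert x A)
  have "inverse_borel m1 m2 (v + w) = inverse_borel m1 m2 v + inverse_borel m1 m2 w" for v w
    by (simp add: fps_eq_iff inverse_borel_nth algebra_simps)
  with insert show ?case by simp
qed (simp_all add: fps_eq_iff inverse_borel_nth)

lemma inverse_borel_cmult:
  "inverse_borel m1 m2 (fps_const (fps_const c) * u) = fps_const (fps_const c) * inverse_borel m1 m2 u"
  by (simp add: fps_eq_iff inverse_borel_nth)

text \<open>
  On both sides the coefficient of \<open>t\<^sup>n\<close> is \<open>m1 (n + 1) * g (n + 1) / g n\<close> times that of \<open>t\<^sup>n\<^sup>+\<^sup>1\<close> in \<open>u\<close>, up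
  to the factor from \<open>m2\<close>: the denominator \<open>m1 n\<close> of the moment quotient cancels.
\<close>

lemma inverse_borel_moment_deriv_t:
  assumes "\<And>n. m1 n \<noteq> 0"
  shows "inverse_borel m1 m2 ((moment_deriv_t (\<lambda>n. m1 n * g n) ^^ i) u) =
    (moment_deriv_t g ^^ i) (inverse_borel m1 m2 u)"
proof -
  have "inverse_borel m1 m2 (moment_deriv_t (\<lambda>n. m1 n * g n) u) = moment_deriv_t g (inverse_borel m1 m2 u)" for u
    using assms by (simp add: fps_eq_iff inverse_borel_nth moment_deriv_t_def)
  thus ?thesis by (induction i) simp_all
qed

lemma inverse_borel_moment_deriv_z:
  assumes "\<And>n. m2 n \<noteq> 0"
  shows "inverse_borel m1 m2 ((moment_deriv_z (\<lambda>n. m2 n * g n) ^^ i) u) =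
    (moment_deriv_z g ^^ i) (inverse_borel m1 m2 u)"
proof -
  have "inverse_borel m1 m2 (moment_deriv_z (\<lambda>n. m2 n * g n) u) = moment_deriv_z g (inverse_borel m1 m2 u)" for u
    using assms by (simp add: fps_eq_iff inverse_borel_nth moment_deriv_z_def moment_deriv_def)
  thus ?thesis by (induction i) simp_all
qed

lemma inverse_borel_moment_pde_op:
  assumes "\<And>n. m1 n \<noteq> 0" "\<And>n. m2 n \<noteq> 0"
  shows "inverse_borel m1 m2 (moment_pde_op P (\<lambda>n. m1 n * g1 n) (\<lambda>n. m2 n * g2 n) u) =
    moment_pde_op P g1 g2 (inverse_borel m1 m2 u)"
  unfolding moment_pde_op_def inverse_borel_sum inverse_borel_cmult
    inverse_borel_moment_deriv_t[OF assms(1)] inverse_borel_moment_deriv_z[OF assms(2)] ..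

text \<open>
  Injectivity of the operator gives the equivalence of the equations. In the initial conditions
  only the part in \<open>z\<close> of the operator remains, because \<open>m1 0 = 1\<close>.
\<close>

lemma solves_cauchy_inverse_borel_iff:
  assumes m1: "\<And>n. m1 n \<noteq> 0" "m1 0 = 1" and m2: "\<And>n. m2 n \<noteq> 0"
  shows "solves_cauchy P (\<lambda>n. m1 n * g1 n) (\<lambda>n. m2 n * g2 n) \<psi> u \<longleftrightarrow>
    solves_cauchy P g1 g2 (\<lambda>j. borel_fps (\<lambda>n. inverse (m2 n)) (\<psi> j)) (inverse_borel m1 m2 u)"
proof -
  have init: "fps_nth (inverse_borel m1 m2 w) 0 = borel_fps (\<lambda>n. inverse (m2 n)) x \<longleftrightarrow> fps_nth w 0 = x" for w x
    using m1 m2 by (simp add: fps_eq_iff inverse_borel_nth borel_fps_def field_simps)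
  show ?thesis
    unfolding solves_cauchy_def inverse_borel_moment_pde_op[OF m1(1) m2, symmetric]
      inverse_borel_moment_deriv_t[OF m1(1), symmetric] init inverse_borel_eq_0_iff[OF m1(1) m2] ..
qed

theorem theorem4:
  fixes m1 m2 :: "nat \<Rightarrow> real" and s1 s2 :: real
    and P :: "complex poly poly" and \<phi> :: "nat \<Rightarrow> complex \<Rightarrow> complex"
    and u :: "complex fps fps"
  assumes "preserves_summability m1" and "preserves_summability m2"
    and "0 \<le> s1" and "0 \<le> s2"
    and "\<forall>j<degree P. \<exists>r>0. \<phi> j holomorphic_on ball 0 r"
  defines "mt1 \<equiv> (\<lambda>n. m1 n * gamma_seq s1 n)"
    and "mt2 \<equiv> (\<lambda>n. m2 n * gamma_seq s2 n)"
    and "v \<equiv> borel_t (\<lambda>n. inverse (m1 n)) (borel_z (\<lambda>n. inverse (m2 n)) u)"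
  shows "(u \<in> holo_series \<and> solves_cauchy P mt1 mt2 (\<lambda>j. fps_expansion (\<phi> j) 0) u \<longleftrightarrow>
          v \<in> holo_series \<and>
          solves_cauchy P (gamma_seq s1) (gamma_seq s2)
            (\<lambda>j. borel_fps (\<lambda>n. inverse (m2 n)) (fps_expansion (\<phi> j) 0)) v)
       \<and> (\<forall>k>0. \<forall>d. u \<in> holo_summable k d \<longleftrightarrow> v \<in> holo_summable k d)"
proof -
  have m1: "\<And>n. m1 n \<noteq> 0" "m1 0 = 1" and m2: "\<And>n. m2 n \<noteq> 0"
    using assms(1,2) by (auto simp: preserves_summability_def less_imp_neq[symmetric])
  note inv = preserves_summability_inverse[OF assms(1)] preserves_summability_inverse[OF assms(2)]
  have v: "v = inverse_borel m1 m2 u" by (simp add: v_def inverse_borel_def)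
  have u: "u = borel_z m2 (borel_t m1 v)" unfolding v by (rule borel_inverse_borel[OF m1(1) m2, symmetric])
  have "u \<in> holo_series \<longleftrightarrow> v \<in> holo_series"
    using u borel_z_holo_series[OF inv(2)] borel_z_holo_series[OF assms(2)] borel_t_holo_series
    unfolding v_def by metis
  moreover have "u \<in> holo_summable k d \<longleftrightarrow> v \<in> holo_summable k d" if "k > 0" for k d
    using u borel_z_holo_summable[OF inv(2)] borel_z_holo_summable[OF assms(2)]
      borel_t_holo_summable[OF inv(1) that] borel_t_holo_summable[OF assms(1) that]
    unfolding v_def by metis
  ultimately show ?thesis
    unfolding mt1_def mt2_def
    by (subst solves_cauchy_inverse_borel_iff[where ?m1.0 = m1 and ?m2.0 = m2]) (simp_all add: m1 m2 v)
qed

end
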